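(* Let $V$ be a b-complete subsemimodule of $\mathbb{R}_{\max}^n$, let $x\in\mathbb{R}_{\max}^n$ with $x\notin V$, and let $H'=\{h\in\mathbb{R}_{\max}^n\mid h\backslash x\leq h\backslash P_V(x)\}$. Then $$d(x,V)=d(x,H').$$
   Context: $\mathbb{R}_{\max}=\mathbb{R}\cup\{-\infty\}$ with addition $\oplus=\max$ and multiplication $\otimes=+$; $\overline{\mathbb{R}}=\mathbb{R}\cup\{-\infty,+\infty\}$ with the convention $(-\infty)+(+\infty)=(+\infty)+(-\infty)=-\infty$. $\mathbb{R}_{\max}^n$ has the entrywise order, entrywise max as addition, and $x\lambda$ denotes the vector with entries $x_i+\lambda$. The symbol $-\infty$ also denotes the vector with all entries $-\infty$. For vectors $x,y$, $x\backslash y:=\max\{\lambda\in\overline{\mathbb{R}}\mid x\lambda\leq y\}$. Hilbert's projective distance is $d(x,y):=-\big((x\backslash y)+(y\backslash x)\big)\in\overline{\mathbb{R}}$, and $d(x,M):=\inf_{v\in M}d(x,v)$ for a set $M$. A subsemimodule of $\mathbb{R}_{\max}^n$ is a subset containing the vector $-\infty$ and stable under entrywise max and under $x\mapsto x\lambda$ for all $\lambda\in\mathbb{R}_{\max}$; it is b-complete if the supremum of any of its subsets that is bounded from above belongs to it. For a b-complete subsemimodule $V$, $P_V(x):=\max\{v\in V\mid v\leq x\}$. *)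

theory Defs
  imports "HOL-Analysis.Analysis" "HOL-Library.Lub_Glb"
begin

(* Vectors have type ereal ^ 'n, with the library's entrywise order, so that every entry lies in
   R u {-oo, +oo}. The space R_max ^ n is the subset of the vectors without an entry +oo. *)

definition rmax :: "ereal set" where
  "rmax = {a. a \<noteq> \<infinity>}"

definition rmax_vec :: "(ereal ^ 'n) set" where
  "rmax_vec = {x. \<forall>i. x $ i \<in> rmax}"

(* The convention here is (-oo) + (+oo) = (+oo) + (-oo) = -oo, whereas the library's addition on
   ereal gives +oo in these two cases. *)
definition tmult :: "ereal \<Rightarrow> ereal \<Rightarrow> ereal"  (infixl \<open>\<odot>\<close> 70) where
  "a \<odot> b = (if a = - \<infinity> \<or> b = - \<infinity> then - \<infinity> else a + b)"

definition tscale :: "ereal ^ 'n \<Rightarrow> ereal \<Rightarrow> ereal ^ 'n"  (infixl \<open>\<odot>\<^sub>v\<close> 70) where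
  "x \<odot>\<^sub>v l = (\<chi> i. x $ i \<odot> l)"

definition tadd :: "ereal ^ 'n \<Rightarrow> ereal ^ 'n \<Rightarrow> ereal ^ 'n"  (infixl \<open>\<oplus>\<^sub>v\<close> 65) where
  "x \<oplus>\<^sub>v y = (\<chi> i. max (x $ i) (y $ i))"

definition tzero :: "ereal ^ 'n" where
  "tzero = (\<chi> i. - \<infinity>)"

(* The residual x \ y. *)
definition resid :: "ereal ^ 'n \<Rightarrow> ereal ^ 'n \<Rightarrow> ereal" where
  "resid x y = (GREATEST l. x \<odot>\<^sub>v l \<le> y)"

definition hilbert_dist :: "ereal ^ 'n \<Rightarrow> ereal ^ 'n \<Rightarrow> ereal" where
  "hilbert_dist x y = - (resid x y \<odot> resid y x)"

definition hilbert_dist_set :: "ereal ^ 'n \<Rightarrow> (ereal ^ 'n) set \<Rightarrow> ereal" where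
  "hilbert_dist_set x M = (INF v\<in>M. hilbert_dist x v)"

definition subsemimodule :: "(ereal ^ 'n) set \<Rightarrow> bool" where
  "subsemimodule V \<longleftrightarrow> V \<subseteq> rmax_vec \<and> tzero \<in> V \<and>
     (\<forall>u\<in>V. \<forall>v\<in>V. u \<oplus>\<^sub>v v \<in> V) \<and> (\<forall>u\<in>V. \<forall>l\<in>rmax. u \<odot>\<^sub>v l \<in> V)"

(* Both boundedness and suprema are relative to R_max ^ n: in ereal ^ 'n every set is bounded. *)
definition b_complete :: "(ereal ^ 'n) set \<Rightarrow> bool" where
  "b_complete V \<longleftrightarrow>
     (\<forall>S\<subseteq>V. (\<exists>b. isUb rmax_vec S b) \<longrightarrow> (\<exists>s\<in>V. isLub rmax_vec S s))"

definition tproj :: "(ereal ^ 'n) set \<Rightarrow> ereal ^ 'n \<Rightarrow> ereal ^ 'n" where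
  "tproj V x = (GREATEST v. v \<in> V \<and> v \<le> x)"


(* The maxima in the definitions of resid and tproj exist. *)

lemma tmult_le_iff:
  "a \<odot> l \<le> b \<longleftrightarrow>
     l \<le> (if a = - \<infinity> \<or> b = \<infinity> then \<infinity> else if a = \<infinity> \<or> b = - \<infinity> then - \<infinity> else b - a)"
  by (cases a; cases l; cases b) (auto simp: tmult_def)

lemma resid_greatest:
  shows "x \<odot>\<^sub>v resid x y \<le> y" and "x \<odot>\<^sub>v l \<le> y \<Longrightarrow> l \<le> resid x y"
proof -
  define m where "m = Sup {l. x \<odot>\<^sub>v l \<le> y}"
  have "x \<odot>\<^sub>v m \<le> y"
    unfolding m_def
    by (simp only: less_eq_vec_def tscale_def vec_lambda_beta tmult_le_iff)
      (blast intro: Sup_least)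
  moreover have up: "l \<le> m" if "x \<odot>\<^sub>v l \<le> y" for l
    using that by (auto simp: m_def intro: Sup_upper)
  ultimately have "resid x y = m"
    unfolding resid_def by (intro Greatest_equality)
  then show "x \<odot>\<^sub>v resid x y \<le> y" "x \<odot>\<^sub>v l \<le> y \<Longrightarrow> l \<le> resid x y"
    using \<open>x \<odot>\<^sub>v m \<le> y\<close> up by auto
qed

lemma tproj_greatest:
  assumes "subsemimodule V" "b_complete V" "x \<in> rmax_vec"
  shows "tproj V x \<in> V" and "tproj V x \<le> x" and "v \<in> V \<Longrightarrow> v \<le> x \<Longrightarrow> v \<le> tproj V x"
proof -
  let ?S = "{v \<in> V. v \<le> x}"
  have ub: "isUb rmax_vec ?S x"
    using assms(3) by (auto simp: isUb_def setle_def)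
  then obtain s where s: "s \<in> V" "isLub rmax_vec ?S s"
    using assms(2) unfolding b_complete_def by (metis (lifting) mem_Collect_eq subsetI)
  have "s \<le> x"
    using s(2) ub by (rule isLub_le_isUb)
  moreover have up: "v \<le> s" if "v \<in> V" "v \<le> x" for v
    using isLubD2[OF s(2)] that by auto
  ultimately have "tproj V x = s"
    unfolding tproj_def using s(1) by (intro Greatest_equality) auto
  then show "tproj V x \<in> V" "tproj V x \<le> x" "v \<in> V \<Longrightarrow> v \<le> x \<Longrightarrow> v \<le> tproj V x"
    using s(1) \<open>s \<le> x\<close> up by auto
qed

end

(* The point of V nearest to x is its projection p, and V is contained in H'.  Since p \<le> x, the
   residual p \ x is nonnegative, so d(x, p) is at most the opposite of x \ p.  For h in H',
   (x \ h) + (h \ x) \<le> (x \ h) + (h \ p) \<le> x \ p, so d(x, p) \<le> d(x, h).  *)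
theory Submission
  imports Defs
begin

lemma tmult_assoc: "(a \<odot> b) \<odot> c = a \<odot> (b \<odot> c)"
  by (cases a; cases b; cases c) (auto simp: tmult_def)

text \<open>If \<open>a\<close> or \<open>b\<close> is -oo, the left side is -oo. Otherwise
  \<open>a'\<close> and \<open>b'\<close> exceed -oo as well, and both products are ordinary
  sums.\<close>

lemma tmult_mono: "a \<le> a' \<Longrightarrow> b \<le> b' \<Longrightarrow> a \<odot> b \<le> a' \<odot> b'"
  by (auto simp: tmult_def intro: add_mono)

lemma tmult_zero [simp]: "a \<odot> 0 = a"
  by (simp add: tmult_def)

lemma tscale_tscale: "(x \<odot>\<^sub>v l) \<odot>\<^sub>v m = x \<odot>\<^sub>v (l \<odot> m)"
  by (simp add: tscale_def tmult_assoc)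

lemma tscale_mono: "x \<le> y \<Longrightarrow> x \<odot>\<^sub>v l \<le> y \<odot>\<^sub>v l"
  by (simp add: less_eq_vec_def tscale_def tmult_mono)

lemma tscale_zero [simp]: "x \<odot>\<^sub>v 0 = x"
  by (simp add: tscale_def vec_eq_iff)

text \<open>Scaling by \<open>resid x y\<close> takes \<open>x\<close> below \<open>y\<close>, and
  scaling further by \<open>resid y z\<close> takes it below \<open>z\<close>; maximality of
  \<open>resid x z\<close> concludes.\<close>

lemma resid_triangle: "resid x y \<odot> resid y z \<le> resid x z"
proof (rule resid_greatest(2))
  have "x \<odot>\<^sub>v (resid x y \<odot> resid y z) \<le> y \<odot>\<^sub>v resid y z"
    by (simp add: tscale_tscale [symmetric] tscale_mono resid_greatest(1))
  also have "\<dots> \<le> z"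
    by (rule resid_greatest(1))
  finally show "x \<odot>\<^sub>v (resid x y \<odot> resid y z) \<le> z" .
qed

lemma resid_nonneg: "x \<le> y \<Longrightarrow> 0 \<le> resid x y"
  by (rule resid_greatest(2)) simp

text \<open>An entry of \<open>v\<close> above -oo would be scaled to +oo, which no entry of
  \<open>x\<close> dominates.\<close>

lemma tscale_infty_le:
  assumes "v \<odot>\<^sub>v \<infinity> \<le> x" and "x \<in> rmax_vec"
  shows "v \<odot>\<^sub>v \<infinity> = tzero"
proof -
  have "v $ i \<odot> \<infinity> = - \<infinity>" for i
  proof -
    have "v $ i \<odot> \<infinity> \<le> x $ i" and "x $ i \<noteq> \<infinity>"
      using assms by (auto simp: less_eq_vec_def tscale_def rmax_vec_def rmax_def)
    then show ?thesis
      by (cases "v $ i") (auto simp: tmult_def)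
  qed
  then show ?thesis
    by (simp add: tscale_def tzero_def)
qed

text \<open>Scaling \<open>v\<close> by \<open>resid v x\<close> gives an element of
  \<open>V\<close> below \<open>x\<close>, hence below the greatest such element,
  \<open>tproj V x\<close>. This yields the inclusion of \<open>V\<close> in
  \<open>H'\<close>.\<close>

lemma resid_le_resid_tproj:
  assumes V: "subsemimodule V" "b_complete V" and x: "x \<in> rmax_vec" and v: "v \<in> V"
  shows "resid v x \<le> resid v (tproj V x)"
proof (rule resid_greatest(2), rule tproj_greatest(3) [OF V x])
  show le: "v \<odot>\<^sub>v resid v x \<le> x"
    by (rule resid_greatest(1))
  show "v \<odot>\<^sub>v resid v x \<in> V"
  \<comment> \<open>\<open>V\<close> is closed only under scalars in \<open>rmax\<close>, while a
    residual can be +oo; in that case the scaled vector is \<open>tzero\<close>.\<close>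
  proof (cases "resid v x = \<infinity>")
    case True
    then have "v \<odot>\<^sub>v resid v x = tzero"
      using tscale_infty_le le x by metis
    then show ?thesis
      using V(1) by (simp add: subsemimodule_def)
  next
    case False
    then show ?thesis
      using V(1) v by (simp add: subsemimodule_def rmax_def)
  qed
qed

lemma hilbert_dist_le_of_resid_le:
  assumes "p \<le> x" and "resid h x \<le> resid h p"
  shows "hilbert_dist x p \<le> hilbert_dist x h"
proof -
  have "resid x h \<odot> resid h x \<le> resid x h \<odot> resid h p"
    using assms(2) by (simp add: tmult_mono)
  also have "\<dots> \<le> resid x p"
    by (rule resid_triangle)
  \<comment> \<open>The scalar 0 is the unit of \<open>\<odot>\<close>, so a factor that is at least
    0 can only increase the product.\<close>
  also have "\<dots> \<le> resid x p \<odot> resid p x"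
    using tmult_mono [OF order_refl resid_nonneg [OF assms(1)]] by simp
  finally show ?thesis
    by (simp add: hilbert_dist_def)
qed

theorem corollary4p5:
  fixes V :: "(ereal ^ 'n) set" and x :: "ereal ^ 'n" and H' :: "(ereal ^ 'n) set"
  assumes "subsemimodule V" and "b_complete V"
    and "x \<in> rmax_vec" and "x \<notin> V"
    and "H' = {h \<in> rmax_vec. resid h x \<le> resid h (tproj V x)}"
  shows "hilbert_dist_set x V = hilbert_dist_set x H'"
proof (rule antisym)
  note proj = tproj_greatest [OF assms(1-3)]
  show "hilbert_dist_set x V \<le> hilbert_dist_set x H'"
    unfolding hilbert_dist_set_def
  proof (rule INF_greatest)
    fix h assume "h \<in> H'"
    then have "hilbert_dist x (tproj V x) \<le> hilbert_dist x h"
      using assms(5) proj(2) by (simp add: hilbert_dist_le_of_resid_le)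
    \<comment> \<open>The projection lies in \<open>V\<close>, so its distance bounds the infimum
      from above.\<close>
    then show "(INF v\<in>V. hilbert_dist x v) \<le> hilbert_dist x h"
      using proj(1) by (rule INF_lower2 [rotated])
  qed
  have "V \<subseteq> H'"
    using assms resid_le_resid_tproj by (auto simp: subsemimodule_def)
  then show "hilbert_dist_set x H' \<le> hilbert_dist_set x V"
    unfolding hilbert_dist_set_def by (rule INF_superset_mono) simp
qed

end
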